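(* Let $F:\Pi_{X:\mathcal{U}}X\to X$. Then there is a path (an element of $\mathsf{Path}_{\Pi_{X:\mathcal{U}}X\to X}(F,\lambda\_.\lambda a.a)$) from $F$ to the polymorphic identity function $\lambda\_.\lambda a.a$.
   Context: We work in parametric cubical type theory: Martin-Löf type theory with $\Sigma$-, $\Pi$-types, a unit type $\mathsf{unit}$ with element $\star$, and a universe $\mathcal{U}$ of Kan types, extended by structural path dimensions with path types $\mathsf{Path}_A(M,N)$ and Kan operations, so paths behave like homotopy-type-theoretic identity types (function extensionality for paths holds), and by substructural bridge dimensions (weakening and exchange, no contraction; variables $\mathbf{x},\dots$, constants $\mathbf{0},\mathbf{1}$) with bridge types $\mathsf{Bridge}_{\mathbf{x}.A}(M_{\mathbf{0}},M_{\mathbf{1}})$ (elements $\lambda^{\mathbf{x}}P$, application to fresh dimensions, $\beta$, $\eta$, endpoint rules). Gel-types: for a bridge dimension $\mathbf{r}$, types $A,B$ and a family $R(a,b)$ not depending on $\mathbf{r}$, $\mathsf{Gel}_{\mathbf{r}}(A,B,a.b.R)$ equals $A$ at $\mathbf{0}$ and $B$ at $\mathbf{1}$; its elements $\mathsf{gel}_{\mathbf{r}}(M,N,P)$ ($M:A,N:B,P:R(M,N)$) equal $M$ at $\mathbf{0}$ and $N$ at $\mathbf{1}$; for $Q:\mathsf{Gel}_{\mathbf{x}}(A,B,a.b.R)$ with $\mathbf{x}$ fresh, $\mathsf{ungel}(\mathbf{x}.Q):R(Q[\mathbf{0}/\mathbf{x}],Q[\mathbf{1}/\mathbf{x}])$,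 with $\beta,\eta$; $\mathcal{U}$ is closed under Gel-types. *)

theory Defs
  imports Main
begin

text \<open>
  A deep embedding of parametric cubical type theory. Raw terms are locally nameless: free
  variables carry names, bound ones are de Bruijn indices, so alpha-equivalent terms are equal.
  Term variables, path dimensions and bridge dimensions have separate name spaces and separate
  indices. All rules are stated with named binders (\<open>lam a M\<close>, \<open>path i A M N\<close>, ...), which
  abstract a name; a term put in place of a free variable has no dangling indices when it is
  well typed, so substitution needs no index shifting and cannot capture.
\<close>

section \<open>Raw syntax\<close>

type_synonym name = nat

datatype pdim = P0 | P1 | PF name | PB nat
datatype bdim = B0 | B1 | BF name | BB nat

text \<open>Constraints indexing the tubes of a composition: equations between path dimensions, and
  equations between a bridge dimension and a bridge constant.\<close>

datatype ('p, 'b) fc = PEq 'p 'p | BEq 'b 'b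

type_synonym face = "(pdim, bdim) fc"

text \<open>Arguments under binders: second of \<open>Pi\<close>, \<open>Sig\<close> (one term variable); \<open>Lam\<close> (one term
  variable); first of \<open>Path\<close>, argument of \<open>PLam\<close>, type line of \<open>Coe\<close>, each tube of \<open>Hcom\<close> (one path
  dimension); first of \<open>Bridge\<close>, argument of \<open>BLam\<close>, of \<open>Ungel\<close> (one bridge dimension); relation of
  \<open>Gel\<close> (two term variables, index 1 for the first).\<close>

datatype tm =
    FV name | BV nat
  | Pi tm tm | Lam tm | App tm tm
  | Sig tm tm | Pair tm tm | Fst tm | Snd tm
  | Unit | Star
  | U
  | Path tm tm tm | PLam tm | PApp tm pdim
  | Bridge tm tm tm | BLam tm | BApp tm bdim
  | Gel bdim tm tm tm | GelI bdim tm tm tm | Ungel tm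
  | Coe pdim pdim tm tm
  | Hcom pdim pdim tm tm "(face \<times> tm) list"

text \<open>Replace the leaves of a term by functions that also receive the number of binders of the
  respective sort (term \<open>i\<close>, path \<open>j\<close>, bridge \<open>k\<close>) passed on the way to the leaf.\<close>

fun trav :: "(nat \<Rightarrow> tm \<Rightarrow> tm) \<Rightarrow> (nat \<Rightarrow> pdim \<Rightarrow> pdim) \<Rightarrow> (nat \<Rightarrow> bdim \<Rightarrow> bdim) \<Rightarrow>
    nat \<Rightarrow> nat \<Rightarrow> nat \<Rightarrow> tm \<Rightarrow> tm" where
  "trav f g h i j k (FV a) = f i (FV a)"
| "trav f g h i j k (BV n) = f i (BV n)"
| "trav f g h i j k (Pi A B) = Pi (trav f g h i j k A) (trav f g h (Suc i) j k B)"
| "trav f g h i j k (Lam M) = Lam (trav f g h (Suc i) j k M)"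
| "trav f g h i j k (App M N) = App (trav f g h i j k M) (trav f g h i j k N)"
| "trav f g h i j k (Sig A B) = Sig (trav f g h i j k A) (trav f g h (Suc i) j k B)"
| "trav f g h i j k (Pair M N) = Pair (trav f g h i j k M) (trav f g h i j k N)"
| "trav f g h i j k (Fst M) = Fst (trav f g h i j k M)"
| "trav f g h i j k (Snd M) = Snd (trav f g h i j k M)"
| "trav f g h i j k Unit = Unit"
| "trav f g h i j k Star = Star"
| "trav f g h i j k U = U"
| "trav f g h i j k (Path A M N) =
     Path (trav f g h i (Suc j) k A) (trav f g h i j k M) (trav f g h i j k N)"
| "trav f g h i j k (PLam M) = PLam (trav f g h i (Suc j) k M)"
| "trav f g h i j k (PApp M r) = PApp (trav f g h i j k M) (g j r)"
| "trav f g h i j k (Bridge A M N) =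
     Bridge (trav f g h i j (Suc k) A) (trav f g h i j k M) (trav f g h i j k N)"
| "trav f g h i j k (BLam M) = BLam (trav f g h i j (Suc k) M)"
| "trav f g h i j k (BApp M r) = BApp (trav f g h i j k M) (h k r)"
| "trav f g h i j k (Gel r A B R) =
     Gel (h k r) (trav f g h i j k A) (trav f g h i j k B) (trav f g h (Suc (Suc i)) j k R)"
| "trav f g h i j k (GelI r M N P) =
     GelI (h k r) (trav f g h i j k M) (trav f g h i j k N) (trav f g h i j k P)"
| "trav f g h i j k (Ungel Q) = Ungel (trav f g h i j (Suc k) Q)"
| "trav f g h i j k (Coe r s A M) =
     Coe (g j r) (g j s) (trav f g h i (Suc j) k A) (trav f g h i j k M)"
| "trav f g h i j k (Hcom r s A M ts) =
     Hcom (g j r) (g j s) (trav f g h i j k A) (trav f g h i j k M)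
       (map (\<lambda>(\<phi>, N). (map_fc (g j) (h k) \<phi>, trav f g h i (Suc j) k N)) ts)"

subsection \<open>Substitution for free names and abstraction of names\<close>

definition tsub :: "name \<Rightarrow> tm \<Rightarrow> tm \<Rightarrow> tm" where
  "tsub a N = trav (\<lambda>_ t. if t = FV a then N else t) (\<lambda>_ r. r) (\<lambda>_ r. r) 0 0 0"

definition pdsub :: "name \<Rightarrow> pdim \<Rightarrow> pdim \<Rightarrow> pdim" where
  "pdsub i r r' = (if r' = PF i then r else r')"

definition bdsub :: "name \<Rightarrow> bdim \<Rightarrow> bdim \<Rightarrow> bdim" where
  "bdsub x r r' = (if r' = BF x then r else r')"

definition psub :: "name \<Rightarrow> pdim \<Rightarrow> tm \<Rightarrow> tm" where
  "psub i r = trav (\<lambda>_ t. t) (\<lambda>_. pdsub i r) (\<lambda>_ r. r) 0 0 0"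

definition bsub :: "name \<Rightarrow> bdim \<Rightarrow> tm \<Rightarrow> tm" where
  "bsub x r = trav (\<lambda>_ t. t) (\<lambda>_ r. r) (\<lambda>_. bdsub x r) 0 0 0"

text \<open>\<open>tabs n a M\<close> turns the free variable \<open>a\<close> into the one bound by the \<open>n\<close>-th enclosing binder.\<close>

definition tabs :: "nat \<Rightarrow> name \<Rightarrow> tm \<Rightarrow> tm" where
  "tabs n a = trav (\<lambda>i t. if t = FV a then BV (i + n) else t) (\<lambda>_ r. r) (\<lambda>_ r. r) 0 0 0"

definition pabs :: "name \<Rightarrow> tm \<Rightarrow> tm" where
  "pabs i = trav (\<lambda>_ t. t) (\<lambda>j r. if r = PF i then PB j else r) (\<lambda>_ r. r) 0 0 0"

definition babs :: "name \<Rightarrow> tm \<Rightarrow> tm" where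
  "babs x = trav (\<lambda>_ t. t) (\<lambda>_ r. r) (\<lambda>k r. if r = BF x then BB k else r) 0 0 0"

subsection \<open>Named binders\<close>

definition pi :: "name \<Rightarrow> tm \<Rightarrow> tm \<Rightarrow> tm" where "pi a A B = Pi A (tabs 0 a B)"
definition lam :: "name \<Rightarrow> tm \<Rightarrow> tm" where "lam a M = Lam (tabs 0 a M)"
definition sig :: "name \<Rightarrow> tm \<Rightarrow> tm \<Rightarrow> tm" where "sig a A B = Sig A (tabs 0 a B)"
definition path :: "name \<Rightarrow> tm \<Rightarrow> tm \<Rightarrow> tm \<Rightarrow> tm" where "path i A M N = Path (pabs i A) M N"
definition plam :: "name \<Rightarrow> tm \<Rightarrow> tm" where "plam i M = PLam (pabs i M)"
definition bridge :: "name \<Rightarrow> tm \<Rightarrow> tm \<Rightarrow> tm \<Rightarrow> tm" where "bridge x A M N = Bridge (babs x A) M N"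
definition blam :: "name \<Rightarrow> tm \<Rightarrow> tm" where "blam x M = BLam (babs x M)"
definition gelty :: "bdim \<Rightarrow> tm \<Rightarrow> tm \<Rightarrow> name \<Rightarrow> name \<Rightarrow> tm \<Rightarrow> tm" where
  "gelty r A B a b R = Gel r A B (tabs 0 b (tabs 1 a R))"
definition ungel :: "name \<Rightarrow> tm \<Rightarrow> tm" where "ungel x Q = Ungel (babs x Q)"
definition coe :: "pdim \<Rightarrow> pdim \<Rightarrow> name \<Rightarrow> tm \<Rightarrow> tm \<Rightarrow> tm" where
  "coe r s y A M = Coe r s (pabs y A) M"

type_synonym tube = "face \<times> tm"

text \<open>In \<open>hcom r s A M y ts\<close> the name \<open>y\<close> is bound in the term component of every tube.\<close>

definition hcom :: "pdim \<Rightarrow> pdim \<Rightarrow> tm \<Rightarrow> tm \<Rightarrow> name \<Rightarrow> tube list \<Rightarrow> tm" where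
  "hcom r s A M y ts = Hcom r s A M (map (map_prod id (pabs y)) ts)"

text \<open>Heterogeneous composition along the line \<open>y.A\<close>, derived as usual from \<open>coe\<close> and \<open>hcom\<close>.\<close>

definition com :: "pdim \<Rightarrow> pdim \<Rightarrow> name \<Rightarrow> tm \<Rightarrow> tm \<Rightarrow> tube list \<Rightarrow> tm" where
  "com r s y A M ts =
     hcom r s (psub y s A) (coe r s y A M) y (map (map_prod id (coe (PF y) s y A)) ts)"

section \<open>Contexts\<close>

datatype ('t, 'f) entry = Hyp name 't | PDim name | BDim name | Face 'f

text \<open>The most recent entry is the head of the list.\<close>

type_synonym ctx = "(tm, face) entry list"

abbreviation snoc :: "ctx \<Rightarrow> (tm, face) entry \<Rightarrow> ctx" (infixl "\<triangleright>" 65) where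
  "\<Gamma> \<triangleright> e \<equiv> e # \<Gamma>"

definition tnames :: "ctx \<Rightarrow> name set" where "tnames \<Gamma> = {a. \<exists>A. Hyp a A \<in> set \<Gamma>}"
definition pnames :: "ctx \<Rightarrow> name set" where "pnames \<Gamma> = {i. PDim i \<in> set \<Gamma>}"
definition bnames :: "ctx \<Rightarrow> name set" where "bnames \<Gamma> = {x. BDim x \<in> set \<Gamma>}"

definition pdim_in :: "ctx \<Rightarrow> pdim \<Rightarrow> bool" where
  "pdim_in \<Gamma> r \<longleftrightarrow> r \<in> {P0, P1} \<union> PF ` pnames \<Gamma>"

definition bdim_in :: "ctx \<Rightarrow> bdim \<Rightarrow> bool" where
  "bdim_in \<Gamma> r \<longleftrightarrow> r \<in> {B0, B1} \<union> BF ` bnames \<Gamma>"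

fun face_in :: "ctx \<Rightarrow> face \<Rightarrow> bool" where
  "face_in \<Gamma> (PEq r s) \<longleftrightarrow> pdim_in \<Gamma> r \<and> pdim_in \<Gamma> s"
| "face_in \<Gamma> (BEq r e) \<longleftrightarrow> bdim_in \<Gamma> r \<and> e \<in> {B0, B1}"

subsection \<open>Equality of dimensions under the constraints in a context\<close>

inductive peq :: "ctx \<Rightarrow> pdim \<Rightarrow> pdim \<Rightarrow> bool" for \<Gamma> where
  "pdim_in \<Gamma> r \<Longrightarrow> peq \<Gamma> r r"
| "Face (PEq r s) \<in> set \<Gamma> \<Longrightarrow> peq \<Gamma> r s"
| "peq \<Gamma> r s \<Longrightarrow> peq \<Gamma> s r"
| "peq \<Gamma> r s \<Longrightarrow> peq \<Gamma> s t \<Longrightarrow> peq \<Gamma> r t"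

inductive beq :: "ctx \<Rightarrow> bdim \<Rightarrow> bdim \<Rightarrow> bool" for \<Gamma> where
  "bdim_in \<Gamma> r \<Longrightarrow> beq \<Gamma> r r"
| "Face (BEq r s) \<in> set \<Gamma> \<Longrightarrow> beq \<Gamma> r s"
| "beq \<Gamma> r s \<Longrightarrow> beq \<Gamma> s r"
| "beq \<Gamma> r s \<Longrightarrow> beq \<Gamma> s t \<Longrightarrow> beq \<Gamma> r t"

fun holds :: "ctx \<Rightarrow> face \<Rightarrow> bool" where
  "holds \<Gamma> (PEq r s) \<longleftrightarrow> peq \<Gamma> r s"
| "holds \<Gamma> (BEq r s) \<longleftrightarrow> beq \<Gamma> r s"

fun face_eq :: "ctx \<Rightarrow> face \<Rightarrow> face \<Rightarrow> bool" where
  "face_eq \<Gamma> (PEq r s) (PEq r' s') \<longleftrightarrow> peq \<Gamma> r r' \<and> peq \<Gamma> s s'"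
| "face_eq \<Gamma> (BEq r e) (BEq r' e') \<longleftrightarrow> beq \<Gamma> r r' \<and> e = e'"
| "face_eq \<Gamma> _ _ \<longleftrightarrow> False"

definition inconsistent :: "ctx \<Rightarrow> bool" where
  "inconsistent \<Gamma> \<longleftrightarrow> peq \<Gamma> P0 P1 \<or> beq \<Gamma> B0 B1"

subsection \<open>Context restriction\<close>

text \<open>\<open>restr \<Gamma> r\<close> is the part of \<open>\<Gamma>\<close> that is apart from the bridge dimension \<open>r\<close>. For a variable it
  drops the variable, all term hypotheses introduced after it (they may depend on it), and the
  constraints mentioning it; other dimensions stay. This makes bridge dimensions substructural:
  a term may be applied to \<open>r\<close> only if it is typed in \<open>restr \<Gamma> r\<close>.\<close>

fun mentions :: "name \<Rightarrow> face \<Rightarrow> bool" where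
  "mentions x (PEq r s) \<longleftrightarrow> False"
| "mentions x (BEq r s) \<longleftrightarrow> r = BF x \<or> s = BF x"

fun restr_var :: "ctx \<Rightarrow> name \<Rightarrow> ctx" where
  "restr_var [] x = []"
| "restr_var (Hyp a A # \<Gamma>) x = restr_var \<Gamma> x"
| "restr_var (PDim i # \<Gamma>) x = PDim i # restr_var \<Gamma> x"
| "restr_var (BDim y # \<Gamma>) x = (if y = x then \<Gamma> else BDim y # restr_var \<Gamma> x)"
| "restr_var (Face \<phi> # \<Gamma>) x =
     (if mentions x \<phi> then restr_var \<Gamma> x else Face \<phi> # restr_var \<Gamma> x)"

definition restr :: "ctx \<Rightarrow> bdim \<Rightarrow> ctx" where
  "restr \<Gamma> r = (case r of BF x \<Rightarrow> restr_var \<Gamma> x | _ \<Rightarrow> \<Gamma>)"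

section \<open>Judgments\<close>

text \<open>Judgments are equations; typing is the reflexive instance. \<open>Small\<close> types are the elements of
  the universe \<open>U\<close>; \<open>Large\<close> covers all types, including \<open>U\<close> itself.\<close>

datatype size = Small | Large

datatype 't jdg = Wf | TyEq size 't 't | ElEq 't 't 't

abbreviation Ty :: "size \<Rightarrow> tm \<Rightarrow> tm jdg" where "Ty l A \<equiv> TyEq l A A"
abbreviation El :: "tm \<Rightarrow> tm \<Rightarrow> tm jdg" where "El M A \<equiv> ElEq M M A"

definition ctx_tsub :: "name \<Rightarrow> tm \<Rightarrow> ctx \<Rightarrow> ctx" where
  "ctx_tsub a N = map (map_entry (tsub a N) id)"
definition ctx_psub :: "name \<Rightarrow> pdim \<Rightarrow> ctx \<Rightarrow> ctx" where
  "ctx_psub i r = map (map_entry (psub i r) (map_fc (pdsub i r) id))"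
definition ctx_bsub :: "name \<Rightarrow> bdim \<Rightarrow> ctx \<Rightarrow> ctx" where
  "ctx_bsub x r = map (map_entry (bsub x r) (map_fc id (bdsub x r)))"

text \<open>Side conditions of \<open>hcom\<close>, relative to a derivability relation \<open>D\<close>: each tube agrees with the
  cap \<open>M\<close> at \<open>r\<close>, and any two tubes agree where both their constraints hold.\<close>

definition tubes_ok ::
  "(ctx \<Rightarrow> tm jdg \<Rightarrow> bool) \<Rightarrow> ctx \<Rightarrow> pdim \<Rightarrow> tm \<Rightarrow> tm \<Rightarrow> name \<Rightarrow> tube list \<Rightarrow> bool" where
  "tubes_ok D \<Gamma> r A M y ts \<longleftrightarrow> y \<notin> pnames \<Gamma> \<and>
     (\<forall>\<phi> N. (\<phi>, N) \<in> set ts \<longrightarrow>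
        face_in \<Gamma> \<phi> \<and> D (\<Gamma> \<triangleright> Face \<phi> \<triangleright> PDim y) (El N A) \<and>
        D (\<Gamma> \<triangleright> Face \<phi>) (ElEq (psub y r N) M A)) \<and>
     (\<forall>\<phi> N \<phi>' N'. (\<phi>, N) \<in> set ts \<longrightarrow> (\<phi>', N') \<in> set ts \<longrightarrow>
        D (\<Gamma> \<triangleright> Face \<phi> \<triangleright> Face \<phi>' \<triangleright> PDim y) (ElEq N N' A))"

definition tubes_eq ::
  "(ctx \<Rightarrow> tm jdg \<Rightarrow> bool) \<Rightarrow> ctx \<Rightarrow> tm \<Rightarrow> name \<Rightarrow> tube list \<Rightarrow> tube list \<Rightarrow> bool" where
  "tubes_eq D \<Gamma> A y ts ts' \<longleftrightarrow> length ts = length ts' \<and>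
     (\<forall>\<phi> N \<phi>' N'. ((\<phi>, N), (\<phi>', N')) \<in> set (zip ts ts') \<longrightarrow>
        face_in \<Gamma> \<phi>' \<and> face_eq \<Gamma> \<phi> \<phi>' \<and> D (\<Gamma> \<triangleright> Face \<phi> \<triangleright> PDim y) (ElEq N N' A))"

lemma tubes_ok_mono [mono]:
  "(\<And>\<Gamma> J. D \<Gamma> J \<longrightarrow> D' \<Gamma> J) \<Longrightarrow> tubes_ok D \<Gamma> r A M y ts \<longrightarrow> tubes_ok D' \<Gamma> r A M y ts"
  unfolding tubes_ok_def by blast

lemma tubes_eq_mono [mono]:
  "(\<And>\<Gamma> J. D \<Gamma> J \<longrightarrow> D' \<Gamma> J) \<Longrightarrow> tubes_eq D \<Gamma> A y ts ts' \<longrightarrow> tubes_eq D' \<Gamma> A y ts ts'"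
  unfolding tubes_eq_def by blast

section \<open>Derivability\<close>

text \<open>A raw type such as \<open>Pi A B\<close> has spurious presentations \<open>pi a A B'\<close> in which \<open>B'\<close> has dangling
  indices. Eliminators therefore have a premise that types the family with its bound name added
  to the context, which rules these out and forces the name to be fresh.\<close>

inductive derives :: "ctx \<Rightarrow> tm jdg \<Rightarrow> bool" (infix "\<turnstile>" 50) where
  \<comment> \<open>Contexts\<close>
  wf_nil: "[] \<turnstile> Wf"
| wf_hyp: "\<Gamma> \<turnstile> Wf \<Longrightarrow> \<Gamma> \<turnstile> Ty Large A \<Longrightarrow> a \<notin> tnames \<Gamma> \<Longrightarrow> \<Gamma> \<triangleright> Hyp a A \<turnstile> Wf"
| wf_pdim: "\<Gamma> \<turnstile> Wf \<Longrightarrow> i \<notin> pnames \<Gamma> \<Longrightarrow> \<Gamma> \<triangleright> PDim i \<turnstile> Wf"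
| wf_bdim: "\<Gamma> \<turnstile> Wf \<Longrightarrow> x \<notin> bnames \<Gamma> \<Longrightarrow> \<Gamma> \<triangleright> BDim x \<turnstile> Wf"
| wf_face: "\<Gamma> \<turnstile> Wf \<Longrightarrow> face_in \<Gamma> \<phi> \<Longrightarrow> \<Gamma> \<triangleright> Face \<phi> \<turnstile> Wf"

  \<comment> \<open>Structural rules. A bridge dimension \<open>r\<close> may replace a bridge variable only in a judgment apart
      from \<open>r\<close>, so these rules give weakening and exchange but no contraction of bridge dimensions.\<close>
| var: "\<Gamma> \<turnstile> Wf \<Longrightarrow> Hyp a A \<in> set \<Gamma> \<Longrightarrow> \<Gamma> \<turnstile> El (FV a) A"
| weaken: "\<Delta> @ \<Gamma> \<turnstile> J \<Longrightarrow> \<Delta> @ (\<Gamma> \<triangleright> e) \<turnstile> Wf \<Longrightarrow> \<Delta> @ (\<Gamma> \<triangleright> e) \<turnstile> J"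
| subst_tm: "\<Delta> @ (\<Gamma> \<triangleright> Hyp a A) \<turnstile> J \<Longrightarrow> \<Gamma> \<turnstile> El N A \<Longrightarrow>
    ctx_tsub a N \<Delta> @ \<Gamma> \<turnstile> map_jdg (tsub a N) J"
| subst_pdim: "\<Delta> @ (\<Gamma> \<triangleright> PDim i) \<turnstile> J \<Longrightarrow> pdim_in \<Gamma> r \<Longrightarrow>
    ctx_psub i r \<Delta> @ \<Gamma> \<turnstile> map_jdg (psub i r) J"
| subst_bdim: "\<Delta> @ (restr \<Gamma> r \<triangleright> BDim x) \<turnstile> J \<Longrightarrow> bdim_in \<Gamma> r \<Longrightarrow> ctx_bsub x r \<Delta> @ \<Gamma> \<turnstile> Wf \<Longrightarrow>
    ctx_bsub x r \<Delta> @ \<Gamma> \<turnstile> map_jdg (bsub x r) J"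
| cut_face: "\<Delta> @ (\<Gamma> \<triangleright> Face \<phi>) \<turnstile> J \<Longrightarrow> holds \<Gamma> \<phi> \<Longrightarrow> \<Delta> @ \<Gamma> \<turnstile> J"

  \<comment> \<open>Equal arguments give equal results\<close>
| func_tm_ty: "\<Gamma> \<triangleright> Hyp a A \<turnstile> TyEq l B B' \<Longrightarrow> \<Gamma> \<turnstile> ElEq N N' A \<Longrightarrow>
    \<Gamma> \<turnstile> TyEq l (tsub a N B) (tsub a N' B')"
| func_tm_el: "\<Gamma> \<triangleright> Hyp a A \<turnstile> ElEq M M' B \<Longrightarrow> \<Gamma> \<turnstile> ElEq N N' A \<Longrightarrow>
    \<Gamma> \<turnstile> ElEq (tsub a N M) (tsub a N' M') (tsub a N B)"
| func_pdim_ty: "\<Gamma> \<triangleright> PDim i \<turnstile> TyEq l B B' \<Longrightarrow> peq \<Gamma> r r' \<Longrightarrow>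
    \<Gamma> \<turnstile> TyEq l (psub i r B) (psub i r' B')"
| func_pdim_el: "\<Gamma> \<triangleright> PDim i \<turnstile> ElEq M M' B \<Longrightarrow> peq \<Gamma> r r' \<Longrightarrow>
    \<Gamma> \<turnstile> ElEq (psub i r M) (psub i r' M') (psub i r B)"
| func_bdim_ty: "restr \<Gamma> r \<triangleright> BDim x \<turnstile> TyEq l B B' \<Longrightarrow> \<Gamma> \<turnstile> Wf \<Longrightarrow> beq \<Gamma> r e \<Longrightarrow> e \<in> {B0, B1} \<Longrightarrow>
    \<Gamma> \<turnstile> TyEq l (bsub x r B) (bsub x e B')"
| func_bdim_el: "restr \<Gamma> r \<triangleright> BDim x \<turnstile> ElEq M M' B \<Longrightarrow> \<Gamma> \<turnstile> Wf \<Longrightarrow> beq \<Gamma> r e \<Longrightarrow> e \<in> {B0, B1} \<Longrightarrow>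
    \<Gamma> \<turnstile> ElEq (bsub x r M) (bsub x e M') (bsub x r B)"

  \<comment> \<open>Equality and conversion; everything of the same kind is equal under contradictory constraints\<close>
| ty_sym: "\<Gamma> \<turnstile> TyEq l A B \<Longrightarrow> \<Gamma> \<turnstile> TyEq l B A"
| ty_trans: "\<Gamma> \<turnstile> TyEq l A B \<Longrightarrow> \<Gamma> \<turnstile> TyEq l B C \<Longrightarrow> \<Gamma> \<turnstile> TyEq l A C"
| el_sym: "\<Gamma> \<turnstile> ElEq M N A \<Longrightarrow> \<Gamma> \<turnstile> ElEq N M A"
| el_trans: "\<Gamma> \<turnstile> ElEq M N A \<Longrightarrow> \<Gamma> \<turnstile> ElEq N P A \<Longrightarrow> \<Gamma> \<turnstile> ElEq M P A"
| conv: "\<Gamma> \<turnstile> ElEq M N A \<Longrightarrow> \<Gamma> \<turnstile> TyEq Large A B \<Longrightarrow> \<Gamma> \<turnstile> ElEq M N B"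
| absurd_ty: "inconsistent \<Gamma> \<Longrightarrow> \<Gamma> \<turnstile> Ty l A \<Longrightarrow> \<Gamma> \<turnstile> Ty l B \<Longrightarrow> \<Gamma> \<turnstile> TyEq l A B"
| absurd_el: "inconsistent \<Gamma> \<Longrightarrow> \<Gamma> \<turnstile> El M A \<Longrightarrow> \<Gamma> \<turnstile> El N A \<Longrightarrow> \<Gamma> \<turnstile> ElEq M N A"

  \<comment> \<open>Universe (a la Russell)\<close>
| univ: "\<Gamma> \<turnstile> Wf \<Longrightarrow> \<Gamma> \<turnstile> Ty Large U"
| univ_intro: "\<Gamma> \<turnstile> TyEq Small A B \<Longrightarrow> \<Gamma> \<turnstile> ElEq A B U"
| univ_elim: "\<Gamma> \<turnstile> ElEq A B U \<Longrightarrow> \<Gamma> \<turnstile> TyEq Small A B"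
| large: "\<Gamma> \<turnstile> TyEq Small A B \<Longrightarrow> \<Gamma> \<turnstile> TyEq Large A B"

  \<comment> \<open>Dependent functions\<close>
| pi_form: "\<Gamma> \<turnstile> TyEq l A A' \<Longrightarrow> \<Gamma> \<triangleright> Hyp a A \<turnstile> TyEq l B B' \<Longrightarrow> \<Gamma> \<turnstile> TyEq l (pi a A B) (pi a A' B')"
| pi_intro: "\<Gamma> \<triangleright> Hyp a A \<turnstile> ElEq M M' B \<Longrightarrow> \<Gamma> \<turnstile> ElEq (lam a M) (lam a M') (pi a A B)"
| pi_elim: "\<Gamma> \<triangleright> Hyp a A \<turnstile> Ty Large B \<Longrightarrow> \<Gamma> \<turnstile> ElEq M M' (pi a A B) \<Longrightarrow> \<Gamma> \<turnstile> ElEq N N' A \<Longrightarrow>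
    \<Gamma> \<turnstile> ElEq (App M N) (App M' N') (tsub a N B)"
| pi_beta: "\<Gamma> \<triangleright> Hyp a A \<turnstile> El M B \<Longrightarrow> \<Gamma> \<turnstile> El N A \<Longrightarrow>
    \<Gamma> \<turnstile> ElEq (App (lam a M) N) (tsub a N M) (tsub a N B)"
| pi_eta: "\<Gamma> \<turnstile> El M (pi a A B) \<Longrightarrow> a \<notin> tnames \<Gamma> \<Longrightarrow>
    \<Gamma> \<turnstile> ElEq M (lam a (App M (FV a))) (pi a A B)"

  \<comment> \<open>Dependent pairs\<close>
| sig_form: "\<Gamma> \<turnstile> TyEq l A A' \<Longrightarrow> \<Gamma> \<triangleright> Hyp a A \<turnstile> TyEq l B B' \<Longrightarrow> \<Gamma> \<turnstile> TyEq l (sig a A B) (sig a A' B')"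
| sig_intro: "\<Gamma> \<triangleright> Hyp a A \<turnstile> Ty Large B \<Longrightarrow> \<Gamma> \<turnstile> ElEq M M' A \<Longrightarrow> \<Gamma> \<turnstile> ElEq N N' (tsub a M B) \<Longrightarrow>
    \<Gamma> \<turnstile> ElEq (Pair M N) (Pair M' N') (sig a A B)"
| sig_elim1: "\<Gamma> \<turnstile> ElEq M M' (sig a A B) \<Longrightarrow> \<Gamma> \<turnstile> ElEq (Fst M) (Fst M') A"
| sig_elim2: "\<Gamma> \<triangleright> Hyp a A \<turnstile> Ty Large B \<Longrightarrow> \<Gamma> \<turnstile> ElEq M M' (sig a A B) \<Longrightarrow>
    \<Gamma> \<turnstile> ElEq (Snd M) (Snd M') (tsub a (Fst M) B)"
| sig_beta1: "\<Gamma> \<triangleright> Hyp a A \<turnstile> Ty Large B \<Longrightarrow> \<Gamma> \<turnstile> El M A \<Longrightarrow> \<Gamma> \<turnstile> El N (tsub a M B) \<Longrightarrow>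
    \<Gamma> \<turnstile> ElEq (Fst (Pair M N)) M A"
| sig_beta2: "\<Gamma> \<triangleright> Hyp a A \<turnstile> Ty Large B \<Longrightarrow> \<Gamma> \<turnstile> El M A \<Longrightarrow> \<Gamma> \<turnstile> El N (tsub a M B) \<Longrightarrow>
    \<Gamma> \<turnstile> ElEq (Snd (Pair M N)) N (tsub a M B)"
| sig_eta: "\<Gamma> \<turnstile> El M (sig a A B) \<Longrightarrow> \<Gamma> \<turnstile> ElEq M (Pair (Fst M) (Snd M)) (sig a A B)"

  \<comment> \<open>Unit type\<close>
| unit_form: "\<Gamma> \<turnstile> Wf \<Longrightarrow> \<Gamma> \<turnstile> Ty l Unit"
| unit_intro: "\<Gamma> \<turnstile> Wf \<Longrightarrow> \<Gamma> \<turnstile> El Star Unit"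
| unit_eta: "\<Gamma> \<turnstile> El M Unit \<Longrightarrow> \<Gamma> \<turnstile> ElEq M Star Unit"

  \<comment> \<open>Path types\<close>
| path_form: "\<Gamma> \<triangleright> PDim i \<turnstile> TyEq l A A' \<Longrightarrow>
    \<Gamma> \<turnstile> ElEq M0 M0' (psub i P0 A) \<Longrightarrow> \<Gamma> \<turnstile> ElEq M1 M1' (psub i P1 A) \<Longrightarrow>
    \<Gamma> \<turnstile> TyEq l (path i A M0 M1) (path i A' M0' M1')"
| path_intro: "\<Gamma> \<triangleright> PDim i \<turnstile> ElEq M M' A \<Longrightarrow>
    \<Gamma> \<turnstile> ElEq (psub i P0 M) M0 (psub i P0 A) \<Longrightarrow> \<Gamma> \<turnstile> ElEq (psub i P1 M) M1 (psub i P1 A) \<Longrightarrow>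
    \<Gamma> \<turnstile> ElEq (plam i M) (plam i M') (path i A M0 M1)"
| path_elim: "\<Gamma> \<triangleright> PDim i \<turnstile> Ty Large A \<Longrightarrow> \<Gamma> \<turnstile> ElEq P P' (path i A M0 M1) \<Longrightarrow> pdim_in \<Gamma> r \<Longrightarrow>
    \<Gamma> \<turnstile> ElEq (PApp P r) (PApp P' r) (psub i r A)"
| path_zero: "\<Gamma> \<triangleright> PDim i \<turnstile> Ty Large A \<Longrightarrow> \<Gamma> \<turnstile> El P (path i A M0 M1) \<Longrightarrow>
    \<Gamma> \<turnstile> ElEq (PApp P P0) M0 (psub i P0 A)"
| path_one: "\<Gamma> \<triangleright> PDim i \<turnstile> Ty Large A \<Longrightarrow> \<Gamma> \<turnstile> El P (path i A M0 M1) \<Longrightarrow>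
    \<Gamma> \<turnstile> ElEq (PApp P P1) M1 (psub i P1 A)"
| path_beta: "\<Gamma> \<triangleright> PDim i \<turnstile> El M A \<Longrightarrow> pdim_in \<Gamma> r \<Longrightarrow>
    \<Gamma> \<turnstile> ElEq (PApp (plam i M) r) (psub i r M) (psub i r A)"
| path_eta: "\<Gamma> \<turnstile> El P (path i A M0 M1) \<Longrightarrow> i \<notin> pnames \<Gamma> \<Longrightarrow>
    \<Gamma> \<turnstile> ElEq P (plam i (PApp P (PF i))) (path i A M0 M1)"

  \<comment> \<open>Bridge types\<close>
| bridge_form: "\<Gamma> \<triangleright> BDim x \<turnstile> TyEq l A A' \<Longrightarrow>
    \<Gamma> \<turnstile> ElEq M0 M0' (bsub x B0 A) \<Longrightarrow> \<Gamma> \<turnstile> ElEq M1 M1' (bsub x B1 A) \<Longrightarrow>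
    \<Gamma> \<turnstile> TyEq l (bridge x A M0 M1) (bridge x A' M0' M1')"
| bridge_intro: "\<Gamma> \<triangleright> BDim x \<turnstile> ElEq M M' A \<Longrightarrow>
    \<Gamma> \<turnstile> ElEq (bsub x B0 M) M0 (bsub x B0 A) \<Longrightarrow> \<Gamma> \<turnstile> ElEq (bsub x B1 M) M1 (bsub x B1 A) \<Longrightarrow>
    \<Gamma> \<turnstile> ElEq (blam x M) (blam x M') (bridge x A M0 M1)"
| bridge_elim: "restr \<Gamma> r \<triangleright> BDim x \<turnstile> Ty Large A \<Longrightarrow>
    restr \<Gamma> r \<turnstile> ElEq P P' (bridge x A M0 M1) \<Longrightarrow> \<Gamma> \<turnstile> Wf \<Longrightarrow> bdim_in \<Gamma> r \<Longrightarrow>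
    \<Gamma> \<turnstile> ElEq (BApp P r) (BApp P' r) (bsub x r A)"
| bridge_zero: "\<Gamma> \<triangleright> BDim x \<turnstile> Ty Large A \<Longrightarrow> \<Gamma> \<turnstile> El P (bridge x A M0 M1) \<Longrightarrow>
    \<Gamma> \<turnstile> ElEq (BApp P B0) M0 (bsub x B0 A)"
| bridge_one: "\<Gamma> \<triangleright> BDim x \<turnstile> Ty Large A \<Longrightarrow> \<Gamma> \<turnstile> El P (bridge x A M0 M1) \<Longrightarrow>
    \<Gamma> \<turnstile> ElEq (BApp P B1) M1 (bsub x B1 A)"
| bridge_beta: "restr \<Gamma> r \<triangleright> BDim x \<turnstile> El M A \<Longrightarrow> \<Gamma> \<turnstile> Wf \<Longrightarrow> bdim_in \<Gamma> r \<Longrightarrow>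
    \<Gamma> \<turnstile> ElEq (BApp (blam x M) r) (bsub x r M) (bsub x r A)"
| bridge_eta: "\<Gamma> \<turnstile> El P (bridge x A M0 M1) \<Longrightarrow> x \<notin> bnames \<Gamma> \<Longrightarrow>
    \<Gamma> \<turnstile> ElEq P (blam x (BApp P (BF x))) (bridge x A M0 M1)"

  \<comment> \<open>Gel-types\<close>
| gel_form: "restr \<Gamma> r \<turnstile> TyEq l A A' \<Longrightarrow> restr \<Gamma> r \<turnstile> TyEq l B B' \<Longrightarrow>
    restr \<Gamma> r \<triangleright> Hyp a A \<triangleright> Hyp b B \<turnstile> TyEq l R R' \<Longrightarrow> \<Gamma> \<turnstile> Wf \<Longrightarrow> bdim_in \<Gamma> r \<Longrightarrow>
    \<Gamma> \<turnstile> TyEq l (gelty r A B a b R) (gelty r A' B' a b R')"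
| gel_form_zero: "\<Gamma> \<turnstile> Ty l A \<Longrightarrow> \<Gamma> \<turnstile> Ty l B \<Longrightarrow> \<Gamma> \<triangleright> Hyp a A \<triangleright> Hyp b B \<turnstile> Ty l R \<Longrightarrow>
    \<Gamma> \<turnstile> TyEq l (gelty B0 A B a b R) A"
| gel_form_one: "\<Gamma> \<turnstile> Ty l A \<Longrightarrow> \<Gamma> \<turnstile> Ty l B \<Longrightarrow> \<Gamma> \<triangleright> Hyp a A \<triangleright> Hyp b B \<turnstile> Ty l R \<Longrightarrow>
    \<Gamma> \<turnstile> TyEq l (gelty B1 A B a b R) B"
| gel_intro: "restr \<Gamma> r \<triangleright> Hyp a A \<triangleright> Hyp b B \<turnstile> Ty Large R \<Longrightarrow>
    restr \<Gamma> r \<turnstile> ElEq M M' A \<Longrightarrow> restr \<Gamma> r \<turnstile> ElEq N N' B \<Longrightarrow>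
    restr \<Gamma> r \<turnstile> ElEq P P' (tsub b N (tsub a M R)) \<Longrightarrow> \<Gamma> \<turnstile> Wf \<Longrightarrow> bdim_in \<Gamma> r \<Longrightarrow>
    \<Gamma> \<turnstile> ElEq (GelI r M N P) (GelI r M' N' P') (gelty r A B a b R)"
| gel_intro_zero: "\<Gamma> \<triangleright> Hyp a A \<triangleright> Hyp b B \<turnstile> Ty Large R \<Longrightarrow>
    \<Gamma> \<turnstile> El M A \<Longrightarrow> \<Gamma> \<turnstile> El N B \<Longrightarrow> \<Gamma> \<turnstile> El P (tsub b N (tsub a M R)) \<Longrightarrow>
    \<Gamma> \<turnstile> ElEq (GelI B0 M N P) M A"
| gel_intro_one: "\<Gamma> \<triangleright> Hyp a A \<triangleright> Hyp b B \<turnstile> Ty Large R \<Longrightarrow>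
    \<Gamma> \<turnstile> El M A \<Longrightarrow> \<Gamma> \<turnstile> El N B \<Longrightarrow> \<Gamma> \<turnstile> El P (tsub b N (tsub a M R)) \<Longrightarrow>
    \<Gamma> \<turnstile> ElEq (GelI B1 M N P) N B"
| gel_elim: "\<Gamma> \<triangleright> Hyp a A \<triangleright> Hyp b B \<turnstile> Ty Large R \<Longrightarrow>
    \<Gamma> \<triangleright> BDim x \<turnstile> ElEq Q Q' (gelty (BF x) A B a b R) \<Longrightarrow>
    \<Gamma> \<turnstile> ElEq (ungel x Q) (ungel x Q') (tsub b (bsub x B1 Q) (tsub a (bsub x B0 Q) R))"
| gel_beta: "\<Gamma> \<triangleright> Hyp a A \<triangleright> Hyp b B \<turnstile> Ty Large R \<Longrightarrow> x \<notin> bnames \<Gamma> \<Longrightarrow>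
    \<Gamma> \<turnstile> El M A \<Longrightarrow> \<Gamma> \<turnstile> El N B \<Longrightarrow> \<Gamma> \<turnstile> El P (tsub b N (tsub a M R)) \<Longrightarrow>
    \<Gamma> \<turnstile> ElEq (ungel x (GelI (BF x) M N P)) P (tsub b N (tsub a M R))"
| gel_eta: "\<Gamma> \<triangleright> Hyp a A \<triangleright> Hyp b B \<turnstile> Ty Large R \<Longrightarrow>
    \<Gamma> \<triangleright> BDim x \<turnstile> El Q (gelty (BF x) A B a b R) \<Longrightarrow>
    \<Gamma> \<triangleright> BDim x \<turnstile> ElEq Q (GelI (BF x) (bsub x B0 Q) (bsub x B1 Q) (ungel x Q))
      (gelty (BF x) A B a b R)"

  \<comment> \<open>Kan operations: coercion along a line of types, and homogeneous composition\<close>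
| coe: "\<Gamma> \<triangleright> PDim y \<turnstile> TyEq Large A A' \<Longrightarrow> \<Gamma> \<turnstile> ElEq M M' (psub y r A) \<Longrightarrow> peq \<Gamma> r r' \<Longrightarrow> peq \<Gamma> s s' \<Longrightarrow>
    \<Gamma> \<turnstile> ElEq (coe r s y A M) (coe r' s' y A' M') (psub y s A)"
| coe_id: "\<Gamma> \<triangleright> PDim y \<turnstile> Ty Large A \<Longrightarrow> \<Gamma> \<turnstile> El M (psub y r A) \<Longrightarrow> peq \<Gamma> r s \<Longrightarrow>
    \<Gamma> \<turnstile> ElEq (coe r s y A M) M (psub y s A)"
| hcom: "\<Gamma> \<turnstile> TyEq Large A A' \<Longrightarrow> \<Gamma> \<turnstile> ElEq M M' A \<Longrightarrow> tubes_ok (\<turnstile>) \<Gamma> r A M y ts \<Longrightarrow>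
    tubes_eq (\<turnstile>) \<Gamma> A y ts ts' \<Longrightarrow> peq \<Gamma> r r' \<Longrightarrow> peq \<Gamma> s s' \<Longrightarrow>
    \<Gamma> \<turnstile> ElEq (hcom r s A M y ts) (hcom r' s' A' M' y ts') A"
| hcom_cap: "\<Gamma> \<turnstile> Ty Large A \<Longrightarrow> \<Gamma> \<turnstile> El M A \<Longrightarrow> tubes_ok (\<turnstile>) \<Gamma> r A M y ts \<Longrightarrow> peq \<Gamma> r s \<Longrightarrow>
    \<Gamma> \<turnstile> ElEq (hcom r s A M y ts) M A"
| hcom_tube: "\<Gamma> \<turnstile> Ty Large A \<Longrightarrow> \<Gamma> \<turnstile> El M A \<Longrightarrow> tubes_ok (\<turnstile>) \<Gamma> r A M y ts \<Longrightarrow>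
    pdim_in \<Gamma> r \<Longrightarrow> pdim_in \<Gamma> s \<Longrightarrow> (\<phi>, N) \<in> set ts \<Longrightarrow> holds \<Gamma> \<phi> \<Longrightarrow>
    \<Gamma> \<turnstile> ElEq (hcom r s A M y ts) (psub y s N) A"

  \<comment> \<open>Computation of coercion at each type former (at \<open>Unit\<close> it follows from \<open>unit_eta\<close>)\<close>
| coe_univ: "\<Gamma> \<turnstile> El A U \<Longrightarrow> pdim_in \<Gamma> r \<Longrightarrow> pdim_in \<Gamma> s \<Longrightarrow> \<Gamma> \<turnstile> ElEq (coe r s y U A) A U"
| coe_pi: "\<Gamma> \<triangleright> PDim y \<turnstile> Ty Large A \<Longrightarrow> \<Gamma> \<triangleright> PDim y \<triangleright> Hyp a A \<turnstile> Ty Large B \<Longrightarrow>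
    \<Gamma> \<turnstile> El M (psub y r (pi a A B)) \<Longrightarrow> pdim_in \<Gamma> r \<Longrightarrow> pdim_in \<Gamma> s \<Longrightarrow>
    \<Gamma> \<turnstile> ElEq (coe r s y (pi a A B) M)
      (lam a (coe r s y (tsub a (coe s (PF y) y A (FV a)) B) (App M (coe s r y A (FV a)))))
      (psub y s (pi a A B))"
| coe_sig: "\<Gamma> \<triangleright> PDim y \<turnstile> Ty Large A \<Longrightarrow> \<Gamma> \<triangleright> PDim y \<triangleright> Hyp a A \<turnstile> Ty Large B \<Longrightarrow>
    \<Gamma> \<turnstile> El M (psub y r (sig a A B)) \<Longrightarrow> pdim_in \<Gamma> r \<Longrightarrow> pdim_in \<Gamma> s \<Longrightarrow>
    \<Gamma> \<turnstile> ElEq (coe r s y (sig a A B) M)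
      (Pair (coe r s y A (Fst M)) (coe r s y (tsub a (coe r (PF y) y A (Fst M)) B) (Snd M)))
      (psub y s (sig a A B))"
| coe_path: "\<Gamma> \<triangleright> PDim y \<triangleright> PDim i \<turnstile> Ty Large A \<Longrightarrow>
    \<Gamma> \<triangleright> PDim y \<turnstile> El M0 (psub i P0 A) \<Longrightarrow> \<Gamma> \<triangleright> PDim y \<turnstile> El M1 (psub i P1 A) \<Longrightarrow>
    \<Gamma> \<turnstile> El P (psub y r (path i A M0 M1)) \<Longrightarrow> pdim_in \<Gamma> r \<Longrightarrow> pdim_in \<Gamma> s \<Longrightarrow>
    \<Gamma> \<turnstile> ElEq (coe r s y (path i A M0 M1) P)
      (plam i (com r s y A (PApp P (PF i)) [(PEq (PF i) P0, M0), (PEq (PF i) P1, M1)]))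
      (psub y s (path i A M0 M1))"
| coe_bridge: "\<Gamma> \<triangleright> PDim y \<triangleright> BDim x \<turnstile> Ty Large A \<Longrightarrow>
    \<Gamma> \<triangleright> PDim y \<turnstile> El M0 (bsub x B0 A) \<Longrightarrow> \<Gamma> \<triangleright> PDim y \<turnstile> El M1 (bsub x B1 A) \<Longrightarrow>
    \<Gamma> \<turnstile> El P (psub y r (bridge x A M0 M1)) \<Longrightarrow> pdim_in \<Gamma> r \<Longrightarrow> pdim_in \<Gamma> s \<Longrightarrow>
    \<Gamma> \<turnstile> ElEq (coe r s y (bridge x A M0 M1) P)
      (blam x (com r s y A (BApp P (BF x)) [(BEq (BF x) B0, M0), (BEq (BF x) B1, M1)]))
      (psub y s (bridge x A M0 M1))"
| coe_gel: "\<Gamma> \<triangleright> PDim y \<turnstile> Ty Large A \<Longrightarrow> \<Gamma> \<triangleright> PDim y \<turnstile> Ty Large B \<Longrightarrow>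
    \<Gamma> \<triangleright> PDim y \<triangleright> Hyp a A \<triangleright> Hyp b B \<turnstile> Ty Large R \<Longrightarrow>
    \<Gamma> \<triangleright> BDim x \<turnstile> El Q (psub y r (gelty (BF x) A B a b R)) \<Longrightarrow> pdim_in \<Gamma> r \<Longrightarrow> pdim_in \<Gamma> s \<Longrightarrow>
    Q0 = bsub x B0 Q \<Longrightarrow> Q1 = bsub x B1 Q \<Longrightarrow>
    \<Gamma> \<triangleright> BDim x \<turnstile> ElEq (coe r s y (gelty (BF x) A B a b R) Q)
      (GelI (BF x) (coe r s y A Q0) (coe r s y B Q1)
        (coe r s y (tsub b (coe r (PF y) y B Q1) (tsub a (coe r (PF y) y A Q0) R)) (ungel x Q)))
      (psub y s (gelty (BF x) A B a b R))"

  \<comment> \<open>Computation of homogeneous composition at each type former\<close>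
| hcom_pi: "\<Gamma> \<triangleright> Hyp a A \<turnstile> Ty Large B \<Longrightarrow> \<Gamma> \<turnstile> El M (pi a A B) \<Longrightarrow>
    tubes_ok (\<turnstile>) \<Gamma> r (pi a A B) M y ts \<Longrightarrow> pdim_in \<Gamma> r \<Longrightarrow> pdim_in \<Gamma> s \<Longrightarrow>
    \<Gamma> \<turnstile> ElEq (hcom r s (pi a A B) M y ts)
      (lam a (hcom r s B (App M (FV a)) y (map (\<lambda>(\<phi>, N). (\<phi>, App N (FV a))) ts)))
      (pi a A B)"
| hcom_sig: "\<Gamma> \<triangleright> Hyp a A \<turnstile> Ty Large B \<Longrightarrow> \<Gamma> \<turnstile> El M (sig a A B) \<Longrightarrow>
    tubes_ok (\<turnstile>) \<Gamma> r (sig a A B) M y ts \<Longrightarrow> pdim_in \<Gamma> r \<Longrightarrow> pdim_in \<Gamma> s \<Longrightarrow>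
    fs = map (\<lambda>(\<phi>, N). (\<phi>, Fst N)) ts \<Longrightarrow> ss = map (\<lambda>(\<phi>, N). (\<phi>, Snd N)) ts \<Longrightarrow>
    \<Gamma> \<turnstile> ElEq (hcom r s (sig a A B) M y ts)
      (Pair (hcom r s A (Fst M) y fs)
        (com r s y (tsub a (hcom r (PF y) A (Fst M) y fs) B) (Snd M) ss))
      (sig a A B)"
| hcom_path: "\<Gamma> \<triangleright> PDim i \<turnstile> Ty Large A \<Longrightarrow> i \<noteq> y \<Longrightarrow> \<Gamma> \<turnstile> El P (path i A M0 M1) \<Longrightarrow>
    tubes_ok (\<turnstile>) \<Gamma> r (path i A M0 M1) P y ts \<Longrightarrow> pdim_in \<Gamma> r \<Longrightarrow> pdim_in \<Gamma> s \<Longrightarrow>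
    \<Gamma> \<turnstile> ElEq (hcom r s (path i A M0 M1) P y ts)
      (plam i (hcom r s A (PApp P (PF i)) y
        ((PEq (PF i) P0, M0) # (PEq (PF i) P1, M1) # map (\<lambda>(\<phi>, N). (\<phi>, PApp N (PF i))) ts)))
      (path i A M0 M1)"
| hcom_bridge: "\<Gamma> \<triangleright> BDim x \<turnstile> Ty Large A \<Longrightarrow> \<Gamma> \<turnstile> El P (bridge x A M0 M1) \<Longrightarrow>
    tubes_ok (\<turnstile>) \<Gamma> r (bridge x A M0 M1) P y ts \<Longrightarrow> pdim_in \<Gamma> r \<Longrightarrow> pdim_in \<Gamma> s \<Longrightarrow>
    \<Gamma> \<turnstile> ElEq (hcom r s (bridge x A M0 M1) P y ts)
      (blam x (hcom r s A (BApp P (BF x)) y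
        ((BEq (BF x) B0, M0) # (BEq (BF x) B1, M1) # map (\<lambda>(\<phi>, N). (\<phi>, BApp N (BF x))) ts)))
      (bridge x A M0 M1)"
  \<comment> \<open>In the relation component, tubes on \<open>x = 0\<close> or \<open>x = 1\<close> are dropped; those boundaries of the
      right-hand side are given by its first two components.\<close>
| hcom_gel: "\<Gamma> \<triangleright> Hyp a A \<triangleright> Hyp b B \<turnstile> Ty Large R \<Longrightarrow>
    \<Gamma> \<triangleright> BDim x \<turnstile> El Q (gelty (BF x) A B a b R) \<Longrightarrow>
    tubes_ok (\<turnstile>) (\<Gamma> \<triangleright> BDim x) r (gelty (BF x) A B a b R) Q y ts \<Longrightarrow> pdim_in \<Gamma> r \<Longrightarrow> pdim_in \<Gamma> s \<Longrightarrow>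
    m0 = (\<lambda>t. hcom r t A (bsub x B0 Q) y
      (map (map_prod (map_fc id (bdsub x B0)) (bsub x B0)) ts)) \<Longrightarrow>
    m1 = (\<lambda>t. hcom r t B (bsub x B1 Q) y
      (map (map_prod (map_fc id (bdsub x B1)) (bsub x B1)) ts)) \<Longrightarrow>
    \<Gamma> \<triangleright> BDim x \<turnstile> ElEq (hcom r s (gelty (BF x) A B a b R) Q y ts)
      (GelI (BF x) (m0 s) (m1 s)
        (com r s y (tsub b (m1 (PF y)) (tsub a (m0 (PF y)) R)) (ungel x Q)
          (map (\<lambda>(\<phi>, N). (\<phi>, ungel x N)) (filter (\<lambda>(\<phi>, N). \<not> mentions x \<phi>) ts))))
      (gelty (BF x) A B a b R)"

section \<open>The polymorphic identity\<close>

text \<open>The choice of the names 0 (for the type \<open>X\<close>) and 1 (for its element) is immaterial, since both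
  are abstracted.\<close>

definition poly_id_type :: tm where
  "poly_id_type = pi 0 U (pi 1 (FV 0) (FV 0))"

definition poly_id :: tm where
  "poly_id = lam 0 (lam 1 (FV 1))"

text \<open>The path type in a constant line of types: \<open>A\<close> must contain no dangling path index, which
  is the case for all well-typed \<open>A\<close>.\<close>

abbreviation hpath :: "tm \<Rightarrow> tm \<Rightarrow> tm \<Rightarrow> tm" where
  "hpath A M N \<equiv> Path A M N"

end

theory Submission
  imports Defs
begin

text \<open>
  Reynolds' argument, with the graph of the function \<open>\<star> \<mapsto> a\<close> as relation. For \<open>a : X\<close> the
  Gel-type \<open>G = Gel\<^sub>x(X, unit, c.u. Path\<^sub>X(c, a))\<close> has the element \<open>gel\<^sub>x(a, \<star>, refl)\<close>. Applying
  \<open>F G\<close> to it gives an element of \<open>G\<close> which is \<open>F X a\<close> at \<open>x = 0\<close>, so \<open>ungel\<close> extracts a path from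
  \<open>F X a\<close> to \<open>a\<close>; function extensionality finishes the proof. The construction is carried out
  for a variable \<open>f\<close> in place of \<open>F\<close>, and \<open>F\<close> is substituted at the very end: then every
  substitution along the way acts on an explicit term, and no scoping lemma about the
  arbitrary term \<open>F\<close> is needed.
\<close>

section \<open>Renaming of bound variables and fresh names\<close>

lemmas syntax_defs = pi_def lam_def path_def plam_def gelty_def ungel_def
  tabs_def tsub_def pabs_def psub_def pdsub_def babs_def bsub_def bdsub_def

text \<open>Alpha-renaming: the binders only abstract names, so 0 and 1 give way to any distinct
  pair, in particular to names fresh for the context at hand. With \<open>a = b\<close> the inner
  binder would capture the type variable in the codomain.\<close>

lemma poly_id_type_eq: "a \<noteq> b \<Longrightarrow> poly_id_type = pi a U (pi b (FV a) (FV a))"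
  by (simp add: poly_id_type_def syntax_defs)

lemma poly_id_eq: "a \<noteq> b \<Longrightarrow> poly_id = lam a (lam b (FV b))"
  by (simp add: poly_id_def syntax_defs)

lemma poly_id_type_psub: "psub i r poly_id_type = poly_id_type"
  by (simp add: poly_id_type_def syntax_defs)

lemma tnames_simps [simp]:
  "tnames (\<Gamma> \<triangleright> Hyp a A) = insert a (tnames \<Gamma>)" "tnames (\<Gamma> \<triangleright> PDim i) = tnames \<Gamma>"
  "tnames (\<Gamma> \<triangleright> BDim x) = tnames \<Gamma>"
  by (auto simp: tnames_def)

lemma pnames_simps [simp]:
  "pnames (\<Gamma> \<triangleright> Hyp a A) = pnames \<Gamma>" "pnames (\<Gamma> \<triangleright> PDim i) = insert i (pnames \<Gamma>)"
  "pnames (\<Gamma> \<triangleright> BDim x) = pnames \<Gamma>"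
  by (auto simp: pnames_def)

lemma bnames_simps [simp]:
  "bnames (\<Gamma> \<triangleright> Hyp a A) = bnames \<Gamma>" "bnames (\<Gamma> \<triangleright> PDim i) = bnames \<Gamma>"
  "bnames (\<Gamma> \<triangleright> BDim x) = insert x (bnames \<Gamma>)"
  by (auto simp: bnames_def)

lemma finite_tnames: "finite (tnames \<Gamma>)"
proof -
  have "tnames \<Gamma> \<subseteq> (\<lambda>e. case e of Hyp a A \<Rightarrow> a | _ \<Rightarrow> undefined) ` set \<Gamma>"
    by (force simp: tnames_def)
  then show ?thesis by (rule finite_subset) simp
qed

lemma finite_pnames: "finite (pnames \<Gamma>)"
proof -
  have "pnames \<Gamma> \<subseteq> (\<lambda>e. case e of PDim i \<Rightarrow> i | _ \<Rightarrow> undefined) ` set \<Gamma>"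
    by (force simp: pnames_def)
  then show ?thesis by (rule finite_subset) simp
qed

lemma finite_bnames: "finite (bnames \<Gamma>)"
proof -
  have "bnames \<Gamma> \<subseteq> (\<lambda>e. case e of BDim x \<Rightarrow> x | _ \<Rightarrow> undefined) ` set \<Gamma>"
    by (force simp: bnames_def)
  then show ?thesis by (rule finite_subset) simp
qed

lemma fresh_name: "finite S \<Longrightarrow> \<exists>n. n \<notin> (S :: name set)"
  using ex_new_if_finite infinite_UNIV_nat by blast

lemma restr_head [simp]: "restr (\<Gamma> \<triangleright> BDim x) (BF x) = \<Gamma>"
  by (simp add: restr_def)

lemma bdim_in_head [simp]: "bdim_in (\<Gamma> \<triangleright> BDim x) (BF x)"
  by (simp add: bdim_in_def bnames_def)

section \<open>Typing of the types and applications in the argument\<close>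

lemma var_type:
  assumes "\<Gamma> \<turnstile> Wf" "Hyp X U \<in> set \<Gamma>"
  shows "\<Gamma> \<turnstile> Ty Small (FV X)"
  using assms univ_elim var by blast

lemma hpath_form:
  assumes "\<Gamma> \<turnstile> Wf" "Hyp X U \<in> set \<Gamma>" "\<Gamma> \<turnstile> El M (FV X)" "\<Gamma> \<turnstile> El N (FV X)"
  shows "\<Gamma> \<turnstile> Ty Small (hpath (FV X) M N)"
proof -
  obtain i where i: "i \<notin> pnames \<Gamma>" using fresh_name finite_pnames by blast
  have "\<Gamma> \<triangleright> PDim i \<turnstile> Ty Small (FV X)"
    using assms i by (intro var_type wf_pdim) auto
  from path_form[OF this, of M M N N] assms show ?thesis
    by (simp add: syntax_defs)
qed

lemma wf_hyp_unit: "\<Gamma> \<turnstile> Wf \<Longrightarrow> u \<notin> tnames \<Gamma> \<Longrightarrow> \<Gamma> \<triangleright> Hyp u Unit \<turnstile> Wf"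
  by (blast intro: wf_hyp unit_form)

lemma wf_hyp_var: "\<Gamma> \<turnstile> Wf \<Longrightarrow> Hyp X U \<in> set \<Gamma> \<Longrightarrow> a \<notin> tnames \<Gamma> \<Longrightarrow> \<Gamma> \<triangleright> Hyp a (FV X) \<turnstile> Wf"
  by (blast intro: wf_hyp large var_type)

lemma wf_hyp_univ: "\<Gamma> \<turnstile> Wf \<Longrightarrow> X \<notin> tnames \<Gamma> \<Longrightarrow> \<Gamma> \<triangleright> Hyp X U \<turnstile> Wf"
  by (blast intro: wf_hyp univ)

lemma poly_id_type_form: "\<Gamma> \<turnstile> Wf \<Longrightarrow> \<Gamma> \<turnstile> Ty Large poly_id_type"
proof -
  assume wf: "\<Gamma> \<turnstile> Wf"
  obtain X where X: "X \<notin> tnames \<Gamma>" using fresh_name finite_tnames by blast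
  obtain a where a: "a \<notin> insert X (tnames \<Gamma>)"
    using fresh_name finite_tnames finite_insert by metis
  have wX: "\<Gamma> \<triangleright> Hyp X U \<turnstile> Wf" using wf X by (rule wf_hyp_univ)
  have wa: "\<Gamma> \<triangleright> Hyp X U \<triangleright> Hyp a (FV X) \<turnstile> Wf" using wX a by (intro wf_hyp_var) auto
  have "\<Gamma> \<turnstile> Ty Large (pi X U (pi a (FV X) (FV X)))"
    by (intro pi_form univ wf large var_type wX wa) auto
  then show ?thesis using a by (simp add: poly_id_type_eq[of X a])
qed

text \<open>Instantiating the type variable turns both sides of the arrow into \<open>A\<close>. The
  raw \<open>Pi A A\<close> avoids a bound name, which would have to be fresh for the arbitrary term
  \<open>A\<close>. The equational form later serves to replace \<open>G B0\<close> by
  \<open>FV X\<close>.\<close>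

lemma poly_app1:
  assumes wf: "\<Gamma> \<turnstile> Wf" and f: "\<Gamma> \<turnstile> ElEq f f' poly_id_type" and A: "\<Gamma> \<turnstile> ElEq A A' U"
  shows "\<Gamma> \<turnstile> ElEq (App f A) (App f' A') (Pi A A)"
proof -
  obtain X where X: "X \<notin> tnames \<Gamma>" using fresh_name finite_tnames by blast
  obtain a where a: "a \<notin> insert X (tnames \<Gamma>)"
    using fresh_name finite_tnames finite_insert by metis
  have wX: "\<Gamma> \<triangleright> Hyp X U \<turnstile> Wf" using wf X by (rule wf_hyp_univ)
  have wa: "\<Gamma> \<triangleright> Hyp X U \<triangleright> Hyp a (FV X) \<turnstile> Wf" using wX a by (intro wf_hyp_var) auto
  have B: "\<Gamma> \<triangleright> Hyp X U \<turnstile> Ty Large (pi a (FV X) (FV X))"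
    by (intro pi_form large var_type wX wa) auto
  have "\<Gamma> \<turnstile> ElEq f f' (pi X U (pi a (FV X) (FV X)))"
    using f a by (simp add: poly_id_type_eq[of X a])
  from pi_elim[OF B this A] show ?thesis
    using a by (simp add: syntax_defs)
qed

text \<open>The last two assumptions stand in for \<open>b\<close> not occurring in
  \<open>A\<close>: they make \<open>Pi A A\<close> equal to \<open>pi b A A\<close> and the
  instantiated codomain equal to \<open>A\<close>. For an explicit \<open>A\<close> both hold by
  computation.\<close>

lemma Pi_const_app:
  assumes "\<Delta> \<turnstile> Wf" "\<Delta> \<turnstile> Ty Large A" "\<Delta> \<turnstile> ElEq M M' (Pi A A)" "\<Delta> \<turnstile> ElEq N N' A"
    and "b \<notin> tnames \<Delta>" and "tabs 0 b A = A" and "tsub b N A = A"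
  shows "\<Delta> \<turnstile> ElEq (App M N) (App M' N') A"
proof -
  have "\<Delta> \<triangleright> Hyp b A \<turnstile> Wf" using assms by (intro wf_hyp)
  then have "\<Delta> \<triangleright> Hyp b A \<turnstile> Ty Large A" using weaken[of "[]"] assms by simp
  from pi_elim[OF this, of M M' N N'] show ?thesis using assms by (simp add: pi_def)
qed

section \<open>The Gel-type of the graph and the path extracted from it\<close>

locale reynolds =
  fixes \<Gamma> :: ctx and f X a c u x :: name
  assumes wf: "\<Gamma> \<turnstile> Wf"
    and f: "Hyp f poly_id_type \<in> set \<Gamma>" and X: "Hyp X U \<in> set \<Gamma>"
    and a: "Hyp a (FV X) \<in> set \<Gamma>"
    and c: "c \<notin> tnames \<Gamma>" and u: "u \<notin> insert c (tnames \<Gamma>)" and x: "x \<notin> bnames \<Gamma>"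
begin

definition R :: tm where "R = hpath (FV X) (FV c) (FV a)"
definition refl_a :: tm where "refl_a = PLam (FV a)"
text \<open>With the bridge dimension as an argument, endpoints are plain instances;
  \<open>Q_bsub\<close> then turns endpoint substitution into application.\<close>

definition G :: "bdim \<Rightarrow> tm" where "G r = gelty r (FV X) Unit c u R"
definition gel_a :: "bdim \<Rightarrow> tm" where "gel_a r = GelI r (FV a) Star refl_a"
definition Q :: "bdim \<Rightarrow> tm" where "Q r = App (App (FV f) (G r)) (gel_a r)"

lemma names_in: "f \<in> tnames \<Gamma>" "X \<in> tnames \<Gamma>" "a \<in> tnames \<Gamma>"
  using f X a by (auto simp: tnames_def)

lemma distinct_names [simp]: "c \<noteq> f" "c \<noteq> X" "c \<noteq> a" "u \<noteq> f" "u \<noteq> X" "u \<noteq> a" "u \<noteq> c"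
  "f \<noteq> c" "X \<noteq> c" "a \<noteq> c" "f \<noteq> u" "X \<noteq> u" "a \<noteq> u" "c \<noteq> u"
  using names_in c u by auto

lemma wfx: "\<Gamma> \<triangleright> BDim x \<turnstile> Wf"
  using wf x by (rule wf_bdim)

lemma R_form: "\<Gamma> \<triangleright> Hyp c (FV X) \<triangleright> Hyp u Unit \<turnstile> Ty Small R"
proof -
  have "\<Gamma> \<triangleright> Hyp c (FV X) \<triangleright> Hyp u Unit \<turnstile> Wf"
    using wf X c u by (intro wf_hyp_unit wf_hyp_var) auto
  then show ?thesis
    unfolding R_def using X a by (intro hpath_form var) auto
qed

text \<open>\<open>u\<close> does not occur in \<open>R\<close>, but it may occur in the arbitrary
  \<open>M\<close>, hence the remaining \<open>tsub u N M\<close>.\<close>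

lemma R_inst: "tsub u N (tsub c M R) = hpath (FV X) (tsub u N M) (FV a)"
  by (simp add: R_def syntax_defs)

lemma refl_a: "\<Gamma> \<turnstile> El refl_a (hpath (FV X) (FV a) (FV a))"
proof -
  obtain i where i: "i \<notin> pnames \<Gamma>" using fresh_name finite_pnames by blast
  have "\<Gamma> \<triangleright> PDim i \<turnstile> El (FV a) (FV X)"
    using wf a i by (intro var wf_pdim) auto
  moreover have "\<Gamma> \<turnstile> El (FV a) (FV X)"
    using wf a by (rule var)
  ultimately show ?thesis
    using path_intro[of i \<Gamma> "FV a" "FV a" "FV X" "FV a" "FV a"] by (simp add: refl_a_def syntax_defs)
qed

lemma refl_a_R: "\<Gamma> \<turnstile> El refl_a (tsub u Star (tsub c (FV a) R))"
proof -
  have "tsub u Star (FV a) = FV a" by (simp add: syntax_defs)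
  then show ?thesis using refl_a by (simp add: R_inst)
qed

text \<open>The apartness premises are met because restricting
  \<open>\<Gamma> \<triangleright> BDim x\<close> at \<open>x\<close> gives back
  \<open>\<Gamma>\<close>, over which \<open>FV X\<close>, \<open>Unit\<close> and \<open>R\<close>
  are typed.\<close>

lemma G_form: "\<Gamma> \<triangleright> BDim x \<turnstile> Ty Small (G (BF x))"
  unfolding G_def using wf X R_form wfx
  by (intro gel_form) (auto intro: var_type unit_form)

lemma G_zero: "\<Gamma> \<turnstile> TyEq Small (G B0) (FV X)"
  unfolding G_def using wf X R_form
  by (intro gel_form_zero) (auto intro: var_type unit_form)

lemma gel_a_intro: "\<Gamma> \<triangleright> BDim x \<turnstile> El (gel_a (BF x)) (G (BF x))"
  unfolding gel_a_def G_def
  by (rule gel_intro; simp add: wfx)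
    (blast intro: large R_form var wf a unit_intro refl_a_R)+

lemma gel_a_zero: "\<Gamma> \<turnstile> ElEq (gel_a B0) (FV a) (FV X)"
  unfolding gel_a_def
  by (rule gel_intro_zero; (rule refl_a_R)?) (blast intro: large R_form var wf a unit_intro)+

text \<open>Here parametricity enters: \<open>f\<close> is applied at the Gel-type itself, so its
  value is again an element of \<open>G\<close> over the bridge variable.\<close>

lemma Q_intro: "\<Gamma> \<triangleright> BDim x \<turnstile> El (Q (BF x)) (G (BF x))"
proof -
  have app: "\<Gamma> \<triangleright> BDim x \<turnstile> El (App (FV f) (G (BF x))) (Pi (G (BF x)) (G (BF x)))"
    using f by (intro poly_app1 wfx var univ_intro G_form) auto
  show ?thesis
    unfolding Q_def
    \<comment> \<open>\<open>c\<close> can serve as the bound name: it is fresh for the context and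
      occurs in \<open>G\<close> only bound.\<close>
    by (rule Pi_const_app[OF wfx large[OF G_form] app gel_a_intro, of c])
      (use c in \<open>simp_all add: G_def R_def syntax_defs\<close>)
qed

lemma Q_bsub: "bsub x r (Q (BF x)) = Q r"
  by (simp add: Q_def G_def R_def gel_a_def refl_a_def syntax_defs)

lemma Q_zero: "\<Gamma> \<turnstile> ElEq (Q B0) (App (App (FV f) (FV X)) (FV a)) (FV X)"
proof -
  \<comment> \<open>\<open>poly_app1\<close> types its conclusion by the left-hand argument, so the
    equation is derived from \<open>FV X\<close> to \<open>G B0\<close> to obtain the type
    \<open>Pi (FV X) (FV X)\<close>, and then reversed.\<close>
  have "\<Gamma> \<turnstile> ElEq (App (FV f) (FV X)) (App (FV f) (G B0)) (Pi (FV X) (FV X))"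
    by (intro poly_app1 wf var f univ_intro ty_sym[OF G_zero])
  then have app: "\<Gamma> \<turnstile> ElEq (App (FV f) (G B0)) (App (FV f) (FV X)) (Pi (FV X) (FV X))"
    by (rule el_sym)
  show ?thesis
    unfolding Q_def
    by (rule Pi_const_app[OF wf large[OF var_type[OF wf X]] app gel_a_zero, of c])
      (use c in \<open>simp_all add: syntax_defs\<close>)
qed

definition proof_term :: tm where "proof_term = ungel x (Q (BF x))"

text \<open>\<open>ungel\<close> returns a witness of \<open>R\<close> between the endpoints of
  \<open>Q\<close>; since \<open>R\<close> is a path to \<open>a\<close> whatever its
  \<open>Unit\<close> argument, this is a path starting at \<open>Q B0\<close>.\<close>

lemma proof_term: "\<Gamma> \<turnstile> El proof_term (hpath (FV X) (Q B0) (FV a))"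
proof -
  have "\<Gamma> \<turnstile> El proof_term (tsub u (Q B1) (tsub c (Q B0) R))"
    using gel_elim[OF large[OF R_form] Q_intro[unfolded G_def]]
    by (simp add: Q_bsub proof_term_def)
  moreover have "tsub u N (Q B0) = Q B0" for N
    by (simp add: Q_def G_def R_def gel_a_def refl_a_def syntax_defs)
  ultimately show ?thesis by (simp add: R_inst)
qed

text \<open>No path dimension is free in \<open>proof_term\<close>, so substitution for one reaches
  only the outer argument \<open>s\<close>. This computes the endpoints in the function
  extensionality argument.\<close>

lemma psub_lam_proof_term:
  "psub i r (lam X (lam a (PApp proof_term s))) = lam X (lam a (PApp proof_term (pdsub i r s)))"
  by (simp add: proof_term_def Q_def G_def R_def gel_a_def refl_a_def syntax_defs)

lemma
  shows proof_term_app: "pdim_in \<Gamma> r \<Longrightarrow> \<Gamma> \<turnstile> El (PApp proof_term r) (FV X)"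
    and proof_term_zero: "\<Gamma> \<turnstile> ElEq (PApp proof_term P0) (App (App (FV f) (FV X)) (FV a)) (FV X)"
    and proof_term_one: "\<Gamma> \<turnstile> ElEq (PApp proof_term P1) (FV a) (FV X)"
proof -
  obtain j where j: "j \<notin> pnames \<Gamma>" using fresh_name finite_pnames by blast
  have A: "\<Gamma> \<triangleright> PDim j \<turnstile> Ty Large (FV X)"
    using wf X j by (intro large var_type wf_pdim) auto
  \<comment> \<open>The path rules want a named line of types; the auxiliary name \<open>j\<close>
    presents the constant line at \<open>FV X\<close>.\<close>
  have P: "\<Gamma> \<turnstile> El proof_term (path j (FV X) (Q B0) (FV a))"
    using proof_term by (simp add: path_def pabs_def)
  have s: "psub j r (FV X) = FV X" for r by (simp add: psub_def)
  show "pdim_in \<Gamma> r \<Longrightarrow> \<Gamma> \<turnstile> El (PApp proof_term r) (FV X)"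
    using path_elim[OF A P] by (simp add: s)
  show "\<Gamma> \<turnstile> ElEq (PApp proof_term P0) (App (App (FV f) (FV X)) (FV a)) (FV X)"
    using el_trans[OF path_zero[OF A P, unfolded s] Q_zero] .
  show "\<Gamma> \<turnstile> ElEq (PApp proof_term P1) (FV a) (FV X)"
    using path_one[OF A P] by (simp add: s)
qed

end

section \<open>Function extensionality and substitution of \<open>F\<close> for
  \<open>f\<close>\<close>

theorem theorem11p1:
  fixes \<Gamma> :: ctx and F :: tm
  assumes "\<Gamma> \<turnstile> Wf"
    and "\<Gamma> \<turnstile> El F poly_id_type"
  shows "\<exists>P. \<Gamma> \<turnstile> El P (hpath poly_id_type F poly_id)"
proof -
  obtain f where f: "f \<notin> tnames \<Gamma>" using fresh_name finite_tnames by blast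
  obtain X where X: "X \<notin> insert f (tnames \<Gamma>)"
    using fresh_name finite_tnames finite_insert by metis
  obtain a where a: "a \<notin> insert X (insert f (tnames \<Gamma>))"
    using fresh_name finite_tnames finite_insert by metis
  obtain c where c: "c \<notin> insert a (insert X (insert f (tnames \<Gamma>)))"
    using fresh_name finite_tnames finite_insert by metis
  obtain u where u: "u \<notin> insert c (insert a (insert X (insert f (tnames \<Gamma>))))"
    using fresh_name finite_tnames finite_insert by metis
  obtain x where x: "x \<notin> bnames \<Gamma>" using fresh_name finite_bnames by blast
  obtain i where i: "i \<notin> pnames \<Gamma>" using fresh_name finite_pnames by blast
  define \<Phi> where "\<Phi> = \<Gamma> \<triangleright> Hyp f poly_id_type"
  have wf_\<Phi>: "\<Phi> \<turnstile> Wf"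
    unfolding \<Phi>_def using assms f by (intro wf_hyp poly_id_type_form)
  have wf_i: "\<Phi> \<triangleright> PDim i \<turnstile> Wf"
    using wf_\<Phi> i by (intro wf_pdim) (auto simp: \<Phi>_def)
  \<comment> \<open>The construction is used twice: over \<open>i\<close> for the interior of the
    path, and without \<open>i\<close> for its endpoints.\<close>
  have reynolds: "reynolds (\<Delta> \<triangleright> Hyp X U \<triangleright> Hyp a (FV X)) f X a c u x"
    if "\<Delta> = \<Phi> \<or> \<Delta> = \<Phi> \<triangleright> PDim i" for \<Delta>
  proof
    show "\<Delta> \<triangleright> Hyp X U \<triangleright> Hyp a (FV X) \<turnstile> Wf"
      using that wf_\<Phi> wf_i X a by (intro wf_hyp_var wf_hyp_univ) (auto simp: \<Phi>_def)
  qed (use that X a c u x in \<open>auto simp: \<Phi>_def\<close>)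
  interpret I: reynolds "\<Phi> \<triangleright> PDim i \<triangleright> Hyp X U \<triangleright> Hyp a (FV X)" f X a c u x
    by (rule reynolds) simp
  interpret E: reynolds "\<Phi> \<triangleright> Hyp X U \<triangleright> Hyp a (FV X)" f X a c u x
    by (rule reynolds) simp
  \<comment> \<open>\<open>proof_term\<close> is built from the names alone, not from the context,
    so the typings from \<open>I\<close> and from \<open>E\<close> both apply to
    \<open>M\<close>.\<close>
  define M where "M r = lam X (lam a (PApp E.proof_term r))" for r
  have type_eq: "pi X U (pi a (FV X) (FV X)) = poly_id_type"
    using a by (simp add: poly_id_type_eq[of X a])
  have M_psub: "psub i r (M (PF i)) = M r" for r
    by (simp add: M_def E.psub_lam_proof_term pdsub_def)
  \<comment> \<open>Function extensionality: \<open>X\<close> and \<open>a\<close> are abstracted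
    under the path variable \<open>i\<close>.\<close>
  have "\<Phi> \<triangleright> PDim i \<turnstile> El (M (PF i)) poly_id_type"
    unfolding M_def type_eq[symmetric]
    by (intro pi_intro I.proof_term_app) (simp add: pdim_in_def pnames_def)
  moreover have "\<Phi> \<turnstile> ElEq (M P0) (FV f) poly_id_type"
  proof -
    have X': "\<Phi> \<triangleright> Hyp X U \<turnstile> Wf" using wf_\<Phi> X by (intro wf_hyp_univ) (auto simp: \<Phi>_def)
    have "\<Phi> \<turnstile> ElEq (M P0) (lam X (lam a (App (App (FV f) (FV X)) (FV a)))) poly_id_type"
      unfolding M_def type_eq[symmetric] by (intro pi_intro E.proof_term_zero)
    \<comment> \<open>Two eta steps lead back to \<open>FV f\<close>: one at the inner
      \<open>App (FV f) (FV X)\<close> here, one at \<open>FV f\<close> below.\<close>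
    moreover have "\<Phi> \<turnstile> ElEq (lam X (App (FV f) (FV X)))
        (lam X (lam a (App (App (FV f) (FV X)) (FV a)))) poly_id_type"
    proof -
      have "\<Phi> \<triangleright> Hyp X U \<turnstile> El (App (FV f) (FV X)) (Pi (FV X) (FV X))"
        by (intro poly_app1 X' var) (auto simp: \<Phi>_def)
      then have "\<Phi> \<triangleright> Hyp X U \<turnstile> El (App (FV f) (FV X)) (pi a (FV X) (FV X))"
        using a by (simp add: syntax_defs)
      from pi_eta[OF this] show ?thesis
        unfolding type_eq[symmetric] using a by (intro pi_intro) (auto simp: \<Phi>_def)
    qed
    moreover have "\<Phi> \<turnstile> ElEq (FV f) (lam X (App (FV f) (FV X))) poly_id_type"
      unfolding type_eq[symmetric]
    proof (rule pi_eta)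
      show "\<Phi> \<turnstile> El (FV f) (pi X U (pi a (FV X) (FV X)))"
        unfolding type_eq by (rule var[OF wf_\<Phi>]) (simp add: \<Phi>_def)
    qed (use X in \<open>auto simp: \<Phi>_def\<close>)
    ultimately show ?thesis by (meson el_trans el_sym)
  qed
  moreover have "\<Phi> \<turnstile> ElEq (M P1) poly_id poly_id_type"
  proof -
    have "\<Phi> \<turnstile> ElEq (M P1) (lam X (lam a (FV a))) poly_id_type"
      unfolding M_def type_eq[symmetric] by (intro pi_intro E.proof_term_one)
    moreover have "poly_id = lam X (lam a (FV a))" using a by (simp add: poly_id_eq[of X a])
    ultimately show ?thesis by metis
  qed
  ultimately have "\<Phi> \<turnstile> El (plam i (M (PF i))) (path i poly_id_type (FV f) poly_id)"
    by (intro path_intro) (simp_all add: M_psub poly_id_type_psub)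
  then have "\<Phi> \<turnstile> El (plam i (M (PF i))) (hpath poly_id_type (FV f) poly_id)"
    by (simp add: path_def pabs_def poly_id_type_def pi_def tabs_def)
  \<comment> \<open>\<open>poly_id_type\<close> and \<open>poly_id\<close> are closed, so in the
    type only the left endpoint changes, from \<open>FV f\<close> to \<open>F\<close>.\<close>
  from subst_tm[of "[]", simplified, OF this[unfolded \<Phi>_def] assms(2)]
  show ?thesis
    by (auto simp: ctx_tsub_def tsub_def poly_id_type_def poly_id_def pi_def lam_def tabs_def)
qed

end
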